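(* Let $X\subset\mathbb{R}^d$ and $Y\subset\mathbb{R}$ be non-empty closed sets and $p\ge0$. Let $L:Y\times\mathbb{R}\to[0,\infty)$ be an invariant loss function of lower order $p$, let $f:X\to\mathbb{R}$ be measurable, and let $\mathrm{P}$ be a probability distribution on $X\times Y$ with $\mathcal{R}_{L,\mathrm{P}}(f)<\infty$. Then $|\mathrm{P}|_p<\infty$ if and only if $f\in L_p(\mathrm{P})$.
   Context: A loss function is a measurable $L:Y\times\mathbb{R}\to[0,\infty)$. It is invariant if there is $l:\mathbb{R}\to[0,\infty)$ with $l(0)=0$ and $L(y,t)=l(y-t)$ for all $y\in Y$, $t\in\mathbb{R}$; it is then of lower order $p$ if there is $c>0$ with $l(r)\ge c(|r|^p-1)$ for all $r\in\mathbb{R}$. $\mathcal{R}_{L,\mathrm{P}}(f):=\mathbb{E}_{\mathrm{P}}L(Y,f(X))$ with $(X,Y)\sim\mathrm{P}$. $|\mathrm{P}|_p:=\int_{X\times Y}|y|^p\,d\mathrm{P}(x,y)$ for $p>0$, and $|\mathrm{P}|_0$ is the total variation norm of $\mathrm{P}$ (equal to $1$). $f\in L_p(\mathrm{P})$ means $f$ is measurable with $\mathbb{E}_{\mathrm{P}}|f(X)|^p<\infty$. *)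

theory Defs
  imports "HOL-Probability.Probability"
begin

text \<open>The function \<open>|r|^p\<close> for real \<open>p \<ge> 0\<close>, with \<open>|0|^0 = 1\<close>
  (whereas \<open>0 powr 0 = 0\<close>).\<close>
definition abs_power :: "real \<Rightarrow> real \<Rightarrow> real" where
  "abs_power r p = (if p = 0 then 1 else \<bar>r\<bar> powr p)"

text \<open>A function \<open>L : Y \<times> \<real> \<rightarrow> [0, \<infinity>)\<close> is represented by a total curried function of which only
  the values with first argument in \<open>Y\<close> matter.\<close>
definition loss_function :: "real set \<Rightarrow> (real \<Rightarrow> real \<Rightarrow> real) \<Rightarrow> bool" where
  "loss_function Y L \<longleftrightarrow>
     (\<lambda>(y, t). L y t) \<in> borel_measurable (restrict_space borel Y \<Otimes>\<^sub>M borel) \<and>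
     (\<forall>y\<in>Y. \<forall>t. 0 \<le> L y t)"

definition represents_loss :: "real set \<Rightarrow> (real \<Rightarrow> real \<Rightarrow> real) \<Rightarrow> (real \<Rightarrow> real) \<Rightarrow> bool" where
  "represents_loss Y L l \<longleftrightarrow>
     (\<forall>r. 0 \<le> l r) \<and> l 0 = 0 \<and> (\<forall>y\<in>Y. \<forall>t. L y t = l (y - t))"

definition invariant_loss :: "real set \<Rightarrow> (real \<Rightarrow> real \<Rightarrow> real) \<Rightarrow> bool" where
  "invariant_loss Y L \<longleftrightarrow> loss_function Y L \<and> (\<exists>l. represents_loss Y L l)"

text \<open>For \<open>Y \<noteq> {}\<close> the representing function \<open>l\<close> is uniquely determined by \<open>L\<close>, so the
  existential quantifier over \<open>l\<close> involves no choice.\<close>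
definition lower_order :: "real set \<Rightarrow> (real \<Rightarrow> real \<Rightarrow> real) \<Rightarrow> real \<Rightarrow> bool" where
  "lower_order Y L p \<longleftrightarrow>
     (\<exists>l. represents_loss Y L l \<and> (\<exists>c>0. \<forall>r. l r \<ge> c * (abs_power r p - 1)))"

definition distribution_on ::
    "'a::topological_space set \<Rightarrow> real set \<Rightarrow> ('a \<times> real) measure \<Rightarrow> bool" where
  "distribution_on X Y P \<longleftrightarrow>
     prob_space P \<and> sets P = sets (restrict_space borel X \<Otimes>\<^sub>M restrict_space borel Y)"

definition risk ::
    "(real \<Rightarrow> real \<Rightarrow> real) \<Rightarrow> ('a \<times> real) measure \<Rightarrow> ('a \<Rightarrow> real) \<Rightarrow> ennreal" where
  "risk L P f = (\<integral>\<^sup>+ (x, y). ennreal (L y (f x)) \<partial>P)"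

text \<open>Supremum over finite families of pairwise disjoint measurable sets; no absolute values are
  needed because a measure is nonnegative.\<close>
definition total_variation_norm :: "'a measure \<Rightarrow> ennreal" where
  "total_variation_norm M =
     (SUP \<A>\<in>{\<A>. finite \<A> \<and> disjoint \<A> \<and> \<A> \<subseteq> sets M}. \<Sum>A\<in>\<A>. emeasure M A)"

definition moment :: "('a \<times> real) measure \<Rightarrow> real \<Rightarrow> ennreal" where
  "moment P p =
     (if p = 0 then total_variation_norm P else (\<integral>\<^sup>+ (x, y). ennreal (abs_power y p) \<partial>P))"

definition L_space ::
    "'a::topological_space set \<Rightarrow> ('a \<times> real) measure \<Rightarrow> real \<Rightarrow> ('a \<Rightarrow> real) set" where
  "L_space X P p =
     {f. f \<in> borel_measurable (restrict_space borel X) \<and>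
         (\<integral>\<^sup>+ (x, y). ennreal (abs_power (f x) p) \<partial>P) < \<infinity>}"

end

theory Submission
  imports Defs
begin

text \<open>The elementary inequality \<open>|a|\<^sup>p \<le> 2\<^sup>p (|a - b|\<^sup>p + |b|\<^sup>p)\<close>, applied with \<open>a, b\<close> being
  \<open>y, f x\<close> in either order, reduces both implications to the integrability of \<open>|y - f x|\<^sup>p\<close>,
  which the lower order condition bounds by \<open>L y (f x) / c + 1\<close>.\<close>

text \<open>Settles \<open>moment\<close> for \<open>p = 0\<close>. Additivity turns the sum over a
  disjoint family into the measure of its union, which is at most the total mass.\<close>

lemma total_variation_norm_le_emeasure_space:
  "total_variation_norm M \<le> emeasure M (space M)"
  unfolding total_variation_norm_def
proof (rule SUP_least)
  fix \<A> assume "\<A> \<in> {\<A>. finite \<A> \<and> disjoint \<A> \<and> \<A> \<subseteq> sets M}"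
  then have "(\<Sum>A\<in>\<A>. emeasure M A) = emeasure M (\<Union>A\<in>\<A>. A)"
    by (intro sum_emeasure) (auto simp: disjoint_family_on_def disjoint_def)
  also have "\<dots> \<le> emeasure M (space M)"
    by (rule emeasure_space)
  finally show "(\<Sum>A\<in>\<A>. emeasure M A) \<le> emeasure M (space M)" .
qed

text \<open>By the triangle inequality \<open>a\<close> is in absolute value at most twice the
  larger of \<open>|a - b|\<close> and \<open>|b|\<close>, and the power of that maximum is one of
  the two summands. Only monotonicity of the power enters, not convexity, so exponents below 1 are
  covered.\<close>

lemma abs_powr_le_diff:
  fixes a b p :: real
  assumes "p \<ge> 0"
  shows "\<bar>a\<bar> powr p \<le> 2 powr p * (\<bar>a - b\<bar> powr p + \<bar>b\<bar> powr p)"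
proof -
  have "\<bar>a\<bar> powr p \<le> (2 * max \<bar>a - b\<bar> \<bar>b\<bar>) powr p"
    using assms by (intro powr_mono2) (auto simp: max_def abs_if)
  also have "\<dots> = 2 powr p * max \<bar>a - b\<bar> \<bar>b\<bar> powr p"
    by (simp add: powr_mult)
  also have "\<dots> \<le> 2 powr p * (\<bar>a - b\<bar> powr p + \<bar>b\<bar> powr p)"
    by (intro mult_left_mono) (auto simp: max_def)
  finally show ?thesis .
qed

text \<open>One implication in abstract form: \<open>h\<close> stands for the loss along
  \<open>f\<close>, while \<open>u\<close> and \<open>v\<close> are the label and the prediction in
  either order.\<close>

lemma (in finite_measure) nn_integral_abs_powr_less_top:
  fixes u v h :: "'a \<Rightarrow> real"
  assumes "p \<ge> 0" and "c > 0"
    and [measurable]: "v \<in> borel_measurable M" "h \<in> borel_measurable M"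
    and h_nonneg: "\<And>z. z \<in> space M \<Longrightarrow> h z \<ge> 0"
    and h_ge: "\<And>z. z \<in> space M \<Longrightarrow> h z \<ge> c * (\<bar>u z - v z\<bar> powr p - 1)"
    and h_int: "(\<integral>\<^sup>+ z. ennreal (h z) \<partial>M) < \<infinity>"
    and v_int: "(\<integral>\<^sup>+ z. ennreal (\<bar>v z\<bar> powr p) \<partial>M) < \<infinity>"
  shows "(\<integral>\<^sup>+ z. ennreal (\<bar>u z\<bar> powr p) \<partial>M) < \<infinity>"
proof -
  define K where "K = 2 powr p"
  have K: "K \<ge> 0" by (simp add: K_def)
  have "(\<integral>\<^sup>+ z. ennreal (\<bar>u z\<bar> powr p) \<partial>M)
      \<le> (\<integral>\<^sup>+ z. ennreal (K / c) * ennreal (h z) + ennreal K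
            + ennreal K * ennreal (\<bar>v z\<bar> powr p) \<partial>M)"
  proof (rule nn_integral_mono)
    fix z assume z: "z \<in> space M"
    have "\<bar>u z - v z\<bar> powr p \<le> h z / c + 1"
      using h_ge[OF z] \<open>c > 0\<close> by (simp add: field_simps)
    with abs_powr_le_diff[OF \<open>p \<ge> 0\<close>, of "u z" "v z"]
    have "\<bar>u z\<bar> powr p \<le> K * (h z / c + 1 + \<bar>v z\<bar> powr p)"
      using K by (auto simp: K_def elim!: order_trans intro!: mult_left_mono)
    also have "\<dots> = K / c * h z + K + K * \<bar>v z\<bar> powr p"
      by (simp add: algebra_simps)
    finally have "ennreal (\<bar>u z\<bar> powr p) \<le> ennreal (K / c * h z + K + K * \<bar>v z\<bar> powr p)"
      by (rule ennreal_leI)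
    \<comment> \<open>All three summands are nonnegative, so \<open>ennreal\<close> distributes over
      the sum.\<close>
    then show "ennreal (\<bar>u z\<bar> powr p)
        \<le> ennreal (K / c) * ennreal (h z) + ennreal K + ennreal K * ennreal (\<bar>v z\<bar> powr p)"
      using K h_nonneg[OF z] \<open>c > 0\<close> by (simp add: ennreal_mult'[symmetric] ennreal_plus[symmetric] del: ennreal_plus)
  qed
  also have "\<dots> = ennreal (K / c) * (\<integral>\<^sup>+ z. ennreal (h z) \<partial>M) + ennreal K * emeasure M (space M)
      + ennreal K * (\<integral>\<^sup>+ z. ennreal (\<bar>v z\<bar> powr p) \<partial>M)"
    by (simp add: nn_integral_add nn_integral_cmult)
  \<comment> \<open>The constant \<open>K\<close> comes from the \<open>- 1\<close> in the lower
    bound on \<open>h\<close>; its integral is finite because the measure is.\<close>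
  also have "\<dots> < \<infinity>"
    using h_int v_int emeasure_finite by (auto simp: ennreal_mult_eq_top_iff less_top[symmetric])
  finally show ?thesis .
qed

theorem lemma7:
  fixes X :: "(real ^ 'd) set" and Y :: "real set" and p :: real
    and L :: "real \<Rightarrow> real \<Rightarrow> real" and f :: "real ^ 'd \<Rightarrow> real"
    and P :: "((real ^ 'd) \<times> real) measure"
  assumes "closed X" and "X \<noteq> {}" and "closed Y" and "Y \<noteq> {}"
    and "p \<ge> 0"
    and "invariant_loss Y L" and "lower_order Y L p"
    and "f \<in> borel_measurable (restrict_space borel X)"
    and "distribution_on X Y P"
    and "risk L P f < \<infinity>"
  shows "moment P p < \<infinity> \<longleftrightarrow> f \<in> L_space X P p"
proof -
  from \<open>distribution_on X Y P\<close> interpret prob_space P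
    by (simp add: distribution_on_def)
  have sets_P: "sets P = sets (restrict_space borel X \<Otimes>\<^sub>M restrict_space borel Y)"
    using \<open>distribution_on X Y P\<close> by (simp add: distribution_on_def)
  have space_P: "space P = X \<times> Y"
    using sets_eq_imp_space_eq[OF sets_P] by (simp add: space_pair_measure space_restrict_space)
  note meas_P = measurable_cong_sets[OF sets_P refl]
  show ?thesis
  proof (cases "p = 0")
    case True
    \<comment> \<open>For \<open>p = 0\<close> both sides of the equivalence are true: the norm is
      at most the total mass 1, and the integrand in \<open>L_space\<close> is constantly 1.\<close>
    have "moment P p \<le> 1"
      using total_variation_norm_le_emeasure_space[of P] True
      by (simp add: moment_def emeasure_space_1)
    then have "moment P p < \<infinity>"
      by (rule le_less_trans) simp
    moreover have "f \<in> L_space X P p"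
      using assms(8) True
      by (simp add: L_space_def abs_power_def case_prod_beta' emeasure_space_1)
    ultimately show ?thesis by simp
  next
    case False
    obtain l c where l: "represents_loss Y L l" and c: "c > 0"
      and lower: "\<And>r. l r \<ge> c * (abs_power r p - 1)"
      using \<open>lower_order Y L p\<close> by (auto simp: lower_order_def)
    define h where "h = (\<lambda>z. L (snd z) (f (fst z)))"
    have f_meas: "(\<lambda>z. f (fst z)) \<in> borel_measurable P"
      unfolding meas_P by (rule measurable_compose[OF measurable_fst assms(8)])
    \<comment> \<open>\<open>L\<close> is measurable only on Y times the reals, so composing with it
      requires the label as a map into the restricted space; as a real function it is needed in the
      role of \<open>v\<close>.\<close>
    have y_meas: "snd \<in> measurable P (restrict_space borel Y)"
      unfolding meas_P by (rule measurable_snd)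
    have y_borel: "snd \<in> borel_measurable P"
      using y_meas by (simp add: measurable_restrict_space2_iff)
    have L_meas: "(\<lambda>(y, t). L y t) \<in> borel_measurable (restrict_space borel Y \<Otimes>\<^sub>M borel)"
      using \<open>invariant_loss Y L\<close> by (simp add: invariant_loss_def loss_function_def)
    have h_meas: "h \<in> borel_measurable P"
      using measurable_compose[OF measurable_Pair[OF y_meas f_meas] L_meas] by (simp add: h_def)
    \<comment> \<open>Points of \<open>space P\<close> have their label in \<open>Y\<close>, where
      \<open>l\<close> represents \<open>L\<close>.\<close>
    have h_eq: "h z = l (snd z - f (fst z))" if "z \<in> space P" for z
      using l that by (auto simp: h_def represents_loss_def space_P)
    have h_nonneg: "h z \<ge> 0" if "z \<in> space P" for z
      using l h_eq[OF that] by (simp add: represents_loss_def)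
    have h_ge: "h z \<ge> c * (\<bar>snd z - f (fst z)\<bar> powr p - 1)" if "z \<in> space P" for z
      using lower[of "snd z - f (fst z)"] h_eq[OF that] False by (simp add: abs_power_def)
    have h_ge': "h z \<ge> c * (\<bar>f (fst z) - snd z\<bar> powr p - 1)" if "z \<in> space P" for z
      using h_ge[OF that] by (simp add: abs_minus_commute)
    have h_int: "(\<integral>\<^sup>+ z. ennreal (h z) \<partial>P) < \<infinity>"
      using \<open>risk L P f < \<infinity>\<close> by (simp add: risk_def h_def case_prod_beta')
    have moment: "moment P p = (\<integral>\<^sup>+ z. ennreal (\<bar>snd z\<bar> powr p) \<partial>P)"
      using False by (simp add: moment_def abs_power_def case_prod_beta')
    have L_space: "f \<in> L_space X P p \<longleftrightarrow> (\<integral>\<^sup>+ z. ennreal (\<bar>f (fst z)\<bar> powr p) \<partial>P) < \<infinity>"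
      using False assms(8) by (simp add: L_space_def abs_power_def case_prod_beta')
    show ?thesis
      unfolding moment L_space
      \<comment> \<open>The first instance bounds the label by the prediction (right to left), the
        second the prediction by the label (left to right).\<close>
      using nn_integral_abs_powr_less_top[OF \<open>p \<ge> 0\<close> c f_meas h_meas h_nonneg h_ge h_int]
        nn_integral_abs_powr_less_top[OF \<open>p \<ge> 0\<close> c y_borel h_meas h_nonneg h_ge' h_int]
      by blast
  qed
qed

end
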